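(* Let $n\ge 5$ and $k\ge 1$. The commutator subgroup of the multi-unrestricted braid group $M_kUB_n$ is perfect. Moreover, the symmetric group $S_n$ is the smallest non-abelian finite quotient of $M_kUB_n$.
   Context: The universal virtual braid group $UV_n(k)$ is the group with generators $\rho_i,\sigma_{i,t}$ ($1\le i\le n-1$, $1\le t\le k$) and defining relations: (1) $\rho_i^2=1$; $\rho_i\rho_{i+1}\rho_i=\rho_{i+1}\rho_i\rho_{i+1}$ for $1\le i\le n-2$; $\rho_i\rho_j=\rho_j\rho_i$ for $|i-j|\ge 2$; (2) $\sigma_{i,t}\sigma_{j,\ell}=\sigma_{j,\ell}\sigma_{i,t}$ for $|i-j|\ge 2$ and all $1\le t,\ell\le k$; (3) $\sigma_{i,t}\rho_j=\rho_j\sigma_{i,t}$ for $|i-j|\ge 2$; (4) $\rho_i\rho_{i+1}\sigma_{i,t}=\sigma_{i+1,t}\rho_i\rho_{i+1}$ for $1\le i\le n-2$, $1\le t\le k$. The multi-virtual braid group $M_kVB_n$ has generators $\sigma_i$ and $\rho_i^{(\beta)}$ ($1\le i\le n-1$, $0\le\beta\le k-1$) and is the quotient of $UV_n(k)$ via $q(\rho_i)=\rho_i^{(0)}$, $q(\sigma_{i,t})=\rho_i^{(t)}$ for $1\le t\le k-1$, $q(\sigma_{i,k})=\sigma_i$, obtained by adding to the relations of $UV_n(k)$ (under this identification) the relations $(\rho_i^{(t)})^2=1$ and $\rho_i^{(t)}\rho_{i+1}^{(t)}\rho_i^{(t)}=\rho_{i+1}^{(t)}\rho_i^{(t)}\rho_{i+1}^{(t)}$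 for $1\le t\le k-1$, and $\sigma_i\sigma_{i+1}\sigma_i=\sigma_{i+1}\sigma_i\sigma_{i+1}$. The multi-unrestricted braid group $M_kUB_n$ is the quotient of $M_kVB_n$ by the images under $q$ of both families of forbidden relations: $(F1)$ $\rho_i\sigma_{i+1,t}\sigma_{i,t}=\sigma_{i+1,t}\sigma_{i,t}\rho_{i+1}$ and $(F2)$ $\rho_{i+1}\sigma_{i,t}\sigma_{i+1,t}=\sigma_{i,t}\sigma_{i+1,t}\rho_i$, for all $1\le i\le n-2$, $1\le t\le k$. For $k=1$ it is the unrestricted virtual braid group $UVB_n$. "Smallest" means of least order among the non-abelian finite quotients. A group $G$ is perfect if $G=[G,G]$. *)

theory Defs
  imports "HOL-Algebra.Sym_Groups"
begin

section \<open>Groups given by generators and relations\<close>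

text \<open>A letter \<open>(x, True)\<close> stands for the generator \<open>x\<close>, and \<open>(x, False)\<close> for its formal inverse.
  A relation \<open>l = r\<close> is encoded as the pair of words \<open>(l, r)\<close>.\<close>

type_synonym 'g gword = "('g \<times> bool) list"

definition gwords :: "'g set \<Rightarrow> 'g gword set" where
  "gwords X = lists (X \<times> UNIV)"

definition ginv :: "'g gword \<Rightarrow> 'g gword" where
  "ginv w = rev (map (\<lambda>(x, b). (x, \<not> b)) w)"

text \<open>The least congruence on the words over \<open>X\<close> that contains free cancellation and \<open>R\<close>.\<close>

inductive_set pres_rel :: "'g set \<Rightarrow> ('g gword \<times> 'g gword) set \<Rightarrow> ('g gword \<times> 'g gword) set"
  for X :: "'g set" and R :: "('g gword \<times> 'g gword) set" where
  refl: "w \<in> gwords X \<Longrightarrow> (w, w) \<in> pres_rel X R"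
| sym: "(v, w) \<in> pres_rel X R \<Longrightarrow> (w, v) \<in> pres_rel X R"
| trans: "(u, v) \<in> pres_rel X R \<Longrightarrow> (v, w) \<in> pres_rel X R \<Longrightarrow> (u, w) \<in> pres_rel X R"
| cancel: "u \<in> gwords X \<Longrightarrow> v \<in> gwords X \<Longrightarrow> x \<in> X \<Longrightarrow>
    (u @ [(x, b), (x, \<not> b)] @ v, u @ v) \<in> pres_rel X R"
| relator: "u \<in> gwords X \<Longrightarrow> v \<in> gwords X \<Longrightarrow> (l, r) \<in> R \<Longrightarrow> l \<in> gwords X \<Longrightarrow> r \<in> gwords X \<Longrightarrow>
    (u @ l @ v, u @ r @ v) \<in> pres_rel X R"

definition presented_group :: "'g set \<Rightarrow> ('g gword \<times> 'g gword) set \<Rightarrow> 'g gword set monoid" where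
  "presented_group X R =
    \<lparr> carrier = gwords X // pres_rel X R,
      mult = (\<lambda>A B. \<Union>u\<in>A. \<Union>v\<in>B. pres_rel X R `` {u @ v}),
      one = pres_rel X R `` {[]} \<rparr>"

lemma gwords_simps [simp]:
  "[] \<in> gwords X"
  "(u @ v \<in> gwords X) = (u \<in> gwords X \<and> v \<in> gwords X)"
  "(a # u \<in> gwords X) = (fst a \<in> X \<and> u \<in> gwords X)"
  by (auto simp: gwords_def mem_Times_iff)

lemma ginv_in_gwords: "w \<in> gwords X \<Longrightarrow> ginv w \<in> gwords X"
  by (auto simp: gwords_def ginv_def)

lemma pres_rel_gwords: "(u, v) \<in> pres_rel X R \<Longrightarrow> u \<in> gwords X \<and> v \<in> gwords X"
  by (induction rule: pres_rel.induct) auto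

lemma pres_rel_context:
  assumes "(u, v) \<in> pres_rel X R" "a \<in> gwords X" "b \<in> gwords X"
  shows "(a @ u @ b, a @ v @ b) \<in> pres_rel X R"
  using assms
proof (induction rule: pres_rel.induct)
  case (cancel u v x c)
  then show ?case using pres_rel.cancel[of "a @ u" X "v @ b" x c R] by simp
next
  case (relator u v l r)
  then show ?case using pres_rel.relator[of "a @ u" X "v @ b" l r R] by simp
qed (auto intro: pres_rel.refl pres_rel.sym pres_rel.trans)

lemma pres_rel_append:
  assumes "(u, u') \<in> pres_rel X R" "(v, v') \<in> pres_rel X R"
  shows "(u @ v, u' @ v') \<in> pres_rel X R"
proof -
  note ws = pres_rel_gwords[OF assms(1)] pres_rel_gwords[OF assms(2)]
  have "(u @ v, u' @ v) \<in> pres_rel X R"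
    using pres_rel_context[OF assms(1), of "[]" v] ws by simp
  moreover have "(u' @ v, u' @ v') \<in> pres_rel X R"
    using pres_rel_context[OF assms(2), of u' "[]"] ws by simp
  ultimately show ?thesis by (rule pres_rel.trans)
qed

lemma pres_rel_inv: "w \<in> gwords X \<Longrightarrow> (ginv w @ w, []) \<in> pres_rel X R"
proof (induction w)
  case Nil
  then show ?case by (auto simp: ginv_def intro: pres_rel.refl)
next
  case (Cons a w)
  obtain x b where a: "a = (x, b)" by fastforce
  have "(ginv w @ [(x, \<not> b), (x, \<not> \<not> b)] @ w, ginv w @ w) \<in> pres_rel X R"
    using Cons.prems a by (intro pres_rel.cancel ginv_in_gwords) auto
  moreover have "ginv (a # w) @ a # w = ginv w @ [(x, \<not> b), (x, \<not> \<not> b)] @ w"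
    by (simp add: ginv_def a)
  ultimately show ?case using Cons pres_rel.trans by fastforce
qed

lemma equiv_pres_rel: "equiv (gwords X) (pres_rel X R)"
proof (rule equivI)
  show "pres_rel X R \<subseteq> gwords X \<times> gwords X" using pres_rel_gwords by fast
  show "refl_on (gwords X) (pres_rel X R)" by (auto simp: refl_on_def intro: pres_rel.refl)
  show "sym_on UNIV (pres_rel X R)" by (rule symI) (rule pres_rel.sym)
  show "trans_on UNIV (pres_rel X R)" by (rule transI) (rule pres_rel.trans)
qed

lemma presented_group_carrier_iff:
  "A \<in> carrier (presented_group X R) \<longleftrightarrow> (\<exists>u\<in>gwords X. A = pres_rel X R `` {u})"
  by (auto simp: presented_group_def quotient_def)

lemma presented_group_mult:
  assumes "u \<in> gwords X" "v \<in> gwords X"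
  shows "(pres_rel X R `` {u}) \<otimes>\<^bsub>presented_group X R\<^esub> (pres_rel X R `` {v}) =
    pres_rel X R `` {u @ v}"
proof -
  have "congruent2 (pres_rel X R) (pres_rel X R) (\<lambda>u v. pres_rel X R `` {u @ v})"
    by (intro congruent2I' equiv_class_eq[OF equiv_pres_rel] pres_rel_append)
  from UN_equiv_class2[OF equiv_pres_rel equiv_pres_rel this assms]
  show ?thesis by (simp add: presented_group_def)
qed

lemma group_presented_group: "group (presented_group X R)"
proof (rule groupI)
  have one: "\<one>\<^bsub>presented_group X R\<^esub> = pres_rel X R `` {[]}"
    by (simp add: presented_group_def)
  show "\<one>\<^bsub>presented_group X R\<^esub> \<in> carrier (presented_group X R)"
    using one presented_group_carrier_iff by fastforce
  fix A assume "A \<in> carrier (presented_group X R)"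
  then obtain u where u: "u \<in> gwords X" "A = pres_rel X R `` {u}"
    by (auto simp: presented_group_carrier_iff)
  show "\<one>\<^bsub>presented_group X R\<^esub> \<otimes>\<^bsub>presented_group X R\<^esub> A = A"
    by (simp add: one u presented_group_mult)
  have "(pres_rel X R `` {ginv u}) \<otimes>\<^bsub>presented_group X R\<^esub> A = \<one>\<^bsub>presented_group X R\<^esub>"
    using u equiv_class_eq[OF equiv_pres_rel pres_rel_inv[OF u(1)]]
    by (simp add: one presented_group_mult ginv_in_gwords)
  then show "\<exists>B\<in>carrier (presented_group X R). B \<otimes>\<^bsub>presented_group X R\<^esub> A = \<one>\<^bsub>presented_group X R\<^esub>"
    using u ginv_in_gwords presented_group_carrier_iff by metis
  fix B assume "B \<in> carrier (presented_group X R)"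
  then obtain v where v: "v \<in> gwords X" "B = pres_rel X R `` {v}"
    by (auto simp: presented_group_carrier_iff)
  show "A \<otimes>\<^bsub>presented_group X R\<^esub> B \<in> carrier (presented_group X R)"
    using u v by (auto simp: presented_group_mult presented_group_carrier_iff)
  fix C assume "C \<in> carrier (presented_group X R)"
  then obtain w where w: "w \<in> gwords X" "C = pres_rel X R `` {w}"
    by (auto simp: presented_group_carrier_iff)
  show "(A \<otimes>\<^bsub>presented_group X R\<^esub> B) \<otimes>\<^bsub>presented_group X R\<^esub> C =
      A \<otimes>\<^bsub>presented_group X R\<^esub> (B \<otimes>\<^bsub>presented_group X R\<^esub> C)"
    using u v w by (simp add: presented_group_mult)
qed

definition poswd :: "'g list \<Rightarrow> 'g gword" where
  "poswd xs = map (\<lambda>x. (x, True)) xs"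

section \<open>The universal virtual braid group\<close>

text \<open>\<open>UVrho i\<close> is $\rho_i$ and \<open>UVsig i t\<close> is $\sigma_{i,t}$; indices start at 1.\<close>

datatype uv_gen = UVrho nat | UVsig nat nat

definition uv_gens :: "nat \<Rightarrow> nat \<Rightarrow> uv_gen set" where
  "uv_gens n k = {UVrho i | i. 1 \<le> i \<and> i < n} \<union> {UVsig i t | i t. 1 \<le> i \<and> i < n \<and> 1 \<le> t \<and> t \<le> k}"

definition far :: "nat \<Rightarrow> nat \<Rightarrow> nat \<Rightarrow> bool" where
  "far n i j \<longleftrightarrow> 1 \<le> i \<and> i < n \<and> 1 \<le> j \<and> j < n \<and> \<bar>int i - int j\<bar> \<ge> 2"

definition uv_rels :: "nat \<Rightarrow> nat \<Rightarrow> (uv_gen list \<times> uv_gen list) set" where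
  "uv_rels n k =
    {([UVrho i, UVrho i], []) | i. 1 \<le> i \<and> i < n} \<union>
    {([UVrho i, UVrho (i+1), UVrho i], [UVrho (i+1), UVrho i, UVrho (i+1)]) | i. 1 \<le> i \<and> i + 1 < n} \<union>
    {([UVrho i, UVrho j], [UVrho j, UVrho i]) | i j. far n i j} \<union>
    {([UVsig i t, UVsig j l], [UVsig j l, UVsig i t]) | i j t l.
        far n i j \<and> 1 \<le> t \<and> t \<le> k \<and> 1 \<le> l \<and> l \<le> k} \<union>
    {([UVsig i t, UVrho j], [UVrho j, UVsig i t]) | i j t. far n i j \<and> 1 \<le> t \<and> t \<le> k} \<union>
    {([UVrho i, UVrho (i+1), UVsig i t], [UVsig (i+1) t, UVrho i, UVrho (i+1)]) | i t.
        1 \<le> i \<and> i + 1 < n \<and> 1 \<le> t \<and> t \<le> k}"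

definition UV :: "nat \<Rightarrow> nat \<Rightarrow> uv_gen gword set monoid" where
  "UV n k = presented_group (uv_gens n k) (map_prod poswd poswd ` uv_rels n k)"

text \<open>The two families of forbidden relations.\<close>

definition forbidden_rels :: "nat \<Rightarrow> nat \<Rightarrow> (uv_gen list \<times> uv_gen list) set" where
  "forbidden_rels n k =
    {([UVrho i, UVsig (i+1) t, UVsig i t], [UVsig (i+1) t, UVsig i t, UVrho (i+1)]) | i t.
        1 \<le> i \<and> i + 1 < n \<and> 1 \<le> t \<and> t \<le> k} \<union>
    {([UVrho (i+1), UVsig i t, UVsig (i+1) t], [UVsig i t, UVsig (i+1) t, UVrho i]) | i t.
        1 \<le> i \<and> i + 1 < n \<and> 1 \<le> t \<and> t \<le> k}"

section \<open>The multi-virtual and multi-unrestricted braid groups\<close>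

text \<open>\<open>MVrho \<beta> i\<close> is $\rho_i^{(\beta)}$ (superscript first, starting at 0) and \<open>MVsig i\<close> is $\sigma_i$.\<close>

datatype mv_gen = MVrho nat nat | MVsig nat

definition mv_gens :: "nat \<Rightarrow> nat \<Rightarrow> mv_gen set" where
  "mv_gens n k = {MVrho b i | b i. b < k \<and> 1 \<le> i \<and> i < n} \<union> {MVsig i | i. 1 \<le> i \<and> i < n}"

text \<open>The identification $q$ of the generators of $UV_n(k)$ with those of $M_kVB_n$.\<close>

fun q_gen :: "nat \<Rightarrow> uv_gen \<Rightarrow> mv_gen" where
  "q_gen k (UVrho i) = MVrho 0 i"
| "q_gen k (UVsig i t) = (if t = k then MVsig i else MVrho t i)"

definition q_rels :: "nat \<Rightarrow> (uv_gen list \<times> uv_gen list) set \<Rightarrow> (mv_gen list \<times> mv_gen list) set" where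
  "q_rels k R = map_prod (map (q_gen k)) (map (q_gen k)) ` R"

definition mvb_rels :: "nat \<Rightarrow> nat \<Rightarrow> (mv_gen list \<times> mv_gen list) set" where
  "mvb_rels n k = q_rels k (uv_rels n k) \<union>
    {([MVrho t i, MVrho t i], []) | t i. 1 \<le> t \<and> t < k \<and> 1 \<le> i \<and> i < n} \<union>
    {([MVrho t i, MVrho t (i+1), MVrho t i], [MVrho t (i+1), MVrho t i, MVrho t (i+1)]) | t i.
        1 \<le> t \<and> t < k \<and> 1 \<le> i \<and> i + 1 < n} \<union>
    {([MVsig i, MVsig (i+1), MVsig i], [MVsig (i+1), MVsig i, MVsig (i+1)]) | i. 1 \<le> i \<and> i + 1 < n}"

definition MVB :: "nat \<Rightarrow> nat \<Rightarrow> mv_gen gword set monoid" where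
  "MVB n k = presented_group (mv_gens n k) (map_prod poswd poswd ` mvb_rels n k)"

definition MUB :: "nat \<Rightarrow> nat \<Rightarrow> mv_gen gword set monoid" where
  "MUB n k = presented_group (mv_gens n k)
    (map_prod poswd poswd ` (mvb_rels n k \<union> q_rels k (forbidden_rels n k)))"

lemma group_MUB: "group (MUB n k)"
  unfolding MUB_def by (rule group_presented_group)

lemma q_gen_image: "k \<ge> 1 \<Longrightarrow> q_gen k ` uv_gens n k = mv_gens n k"
proof
  assume k: "k \<ge> 1"
  show "q_gen k ` uv_gens n k \<subseteq> mv_gens n k"
    using k by (fastforce simp: uv_gens_def mv_gens_def)
  show "mv_gens n k \<subseteq> q_gen k ` uv_gens n k"
  proof
    fix x assume "x \<in> mv_gens n k"
    then consider i where "x = MVrho 0 i" "1 \<le> i" "i < n"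
      | t i where "x = MVrho t i" "1 \<le> t" "t < k" "1 \<le> i" "i < n"
      | i where "x = MVsig i" "1 \<le> i" "i < n"
      by (force simp: mv_gens_def)
    then show "x \<in> q_gen k ` uv_gens n k"
    proof cases
      case (1 i)
      then show ?thesis by (intro image_eqI[where x = "UVrho i"]) (auto simp: uv_gens_def)
    next
      case (2 t i)
      then show ?thesis by (intro image_eqI[where x = "UVsig i t"]) (auto simp: uv_gens_def)
    next
      case (3 i)
      then show ?thesis using k by (intro image_eqI[where x = "UVsig i k"]) (auto simp: uv_gens_def)
    qed
  qed
qed

section \<open>Perfect groups and smallest non-abelian finite quotients\<close>

definition perfect_group :: "('a, 'b) monoid_scheme \<Rightarrow> bool" where
  "perfect_group G \<longleftrightarrow> group G \<and> derived G (carrier G) = carrier G"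

definition commutator_subgroup :: "('a, 'b) monoid_scheme \<Rightarrow> ('a, 'b) monoid_scheme" where
  "commutator_subgroup G = G\<lparr>carrier := derived G (carrier G)\<rparr>"

definition nonabelian_finite_group :: "('a, 'b) monoid_scheme \<Rightarrow> bool" where
  "nonabelian_finite_group H \<longleftrightarrow> group H \<and> finite (carrier H) \<and> \<not> comm_group H"

text \<open>Every quotient of \<open>G\<close> is isomorphic to one of the form \<open>G Mod N\<close>, so comparing
  orders with these covers all quotients, whatever the type of their elements.\<close>

definition smallest_nonabelian_finite_quotient ::
    "('a, 'c) monoid_scheme \<Rightarrow> ('b, 'd) monoid_scheme \<Rightarrow> bool" where
  "smallest_nonabelian_finite_quotient G S \<longleftrightarrow>
    nonabelian_finite_group S \<and> (\<exists>N. N \<lhd> G \<and> G Mod N \<cong> S) \<and>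
    (\<forall>N. N \<lhd> G \<and> nonabelian_finite_group (G Mod N) \<longrightarrow> order S \<le> order (G Mod N))"

end

theory Submission
  imports Defs
begin

text \<open>
  Everything is controlled by the images of the involutions \<open>\<rho>\<^sub>i\<close>. Let \<open>h\<close> be a homomorphism from
  the multi-unrestricted braid group to a group \<open>H\<close>.

  First, if all \<open>\<rho>\<^sub>i\<close> have the same image, then the image of \<open>h\<close> is abelian
  (\<open>image_commute_if_rho_equal\<close>): \<open>\<rho>\<^sub>i \<rho>\<^bsub>i+1\<^esub>\<close> becomes trivial, so the mixed relation
  \<open>\<rho>\<^sub>i \<rho>\<^bsub>i+1\<^esub> \<sigma>\<^bsub>i,t\<^esub> = \<sigma>\<^bsub>i+1,t\<^esub> \<rho>\<^sub>i \<rho>\<^bsub>i+1\<^esub>\<close> makes \<open>\<sigma>\<^bsub>i,t\<^esub>\<close> independent of \<open>i\<close>, and then any two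
  generators commute since they may be moved to the far apart positions 1 and 3. Moreover, the
  \<open>\<rho>\<^sub>i\<close> have the same image as soon as two neighbouring ones do (\<open>r_collapse\<close>).

  Perfectness (\<open>derived_MUB_perfect\<close>). Let \<open>D\<close> be the derived subgroup and let \<open>h\<close> be the quotient map
  modulo the derived subgroup of \<open>D\<close>. Both \<open>\<rho>\<^sub>1 \<rho>\<^sub>2\<close> and \<open>\<rho>\<^sub>3 \<rho>\<^sub>4\<close> are commutators, so their images commute. As \<open>\<rho>\<^sub>4\<close>
  commutes with \<open>\<rho>\<^sub>1\<close> and \<open>\<rho>\<^sub>2\<close>, and \<open>\<rho>\<^sub>3\<close> with \<open>\<rho>\<^sub>1\<close>, cancellation leaves that \<open>\<rho>\<^sub>2\<close> and \<open>\<rho>\<^sub>3\<close> commute;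
  the braid relation then identifies them. Hence the quotient is abelian, that is, \<open>D\<close> is contained
  in its own derived subgroup.

  Least order. Sending every generator with index \<open>i\<close> to the transposition of \<open>i\<close> and \<open>i + 1\<close>
  respects all relations, so the symmetric group is a quotient. In a non-abelian quotient \<open>\<rho>\<^sub>1\<close> and
  \<open>\<rho>\<^sub>2\<close> stay different. Instead of using the Coxeter presentation and the normal subgroups of the
  symmetric group, one looks at the elements \<open>x\<^bsub>ij\<^esub>\<close> that a transposition of \<open>i\<close> and \<open>j\<close> should map to
  (\<open>refl_elt\<close>). Conjugation by \<open>\<rho>\<^sub>k\<close> permutes them in the way that the adjacent transposition permutes the
  indices, so every permutation \<open>p\<close> is realised on the \<open>x\<^bsub>ij\<^esub>\<close> by conjugation with some \<open>g\<^sub>p\<close>. For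
  at least five points the \<open>x\<^bsub>ij\<^esub>\<close> are distinct when \<open>\<rho>\<^sub>1\<close> and \<open>\<rho>\<^sub>2\<close> differ, so \<open>p\<close> can be read off from
  \<open>g\<^sub>p\<close>, and the quotient has at least as many elements as there are permutations
  (\<open>fact_le_order\<close>).
\<close>

section \<open>Permutations of an initial segment\<close>

text \<open>Adjacent transpositions generate: a transposition of \<open>a\<close> and \<open>b + 1\<close> is the conjugate of
  that of \<open>a\<close> and \<open>b\<close> by the adjacent one that exchanges \<open>b\<close> and \<open>b + 1\<close>.\<close>

lemma adjacent_transpositions_induct [consumes 1, case_names id adjacent comp]:
  fixes n :: nat
  assumes "p permutes {1..n}"
    and id: "P id"
    and adjacent: "\<And>i. 1 \<le> i \<Longrightarrow> i < n \<Longrightarrow> P (transpose i (Suc i))"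
    and comp: "\<And>p q. p permutes {1..n} \<Longrightarrow> q permutes {1..n} \<Longrightarrow> P p \<Longrightarrow> P q \<Longrightarrow> P (p \<circ> q)"
  shows "P p"
proof -
  have less: "P (transpose a b)" if "1 \<le> a" "a < b" "b \<le> n" for a b
    using that
  proof (induction b)
    case (Suc b)
    show ?case
    proof (cases "a = b")
      case True
      then show ?thesis using Suc.prems by (auto intro: adjacent)
    next
      case False
      have "transpose a (Suc b) = transpose b (Suc b) \<circ> (transpose a b \<circ> transpose b (Suc b))"
        using False Suc.prems by (auto simp: fun_eq_iff transpose_def)
      moreover have "transpose b (Suc b) permutes {1..n}" "transpose a b permutes {1..n}"
        using Suc.prems by (auto intro!: permutes_swap_id)
      moreover have "P (transpose b (Suc b))" "P (transpose a b)"
        using Suc False by (auto intro: adjacent)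
      ultimately show ?thesis by (metis comp permutes_compose)
    qed
  qed simp
  have any: "P (transpose a b)" if "a \<in> {1..n}" "b \<in> {1..n}" "a \<noteq> b" for a b
    using that less[of a b] less[of b a] by (cases "a < b") (auto simp: transpose_commute)
  show ?thesis
    using assms(1) finite_atLeastAtMost
  proof (induction rule: permutes_induct)
    case id
    show ?case by (rule assms(2))
  next
    case (swap a b p)
    then show ?case by (intro comp any permutes_swap_id) auto
  qed
qed

lemma (in group) commutator_in_derived:
  assumes "a \<in> K" "b \<in> K"
  shows "a \<otimes> b \<otimes> inv a \<otimes> inv b \<in> derived G K"
  unfolding derived_def using assms by (intro generate.incl) blast

lemma (in group) commute_if_commutator_trivial:
  assumes a: "a \<in> carrier G" and b: "b \<in> carrier G" and "a \<otimes> b \<otimes> inv a \<otimes> inv b = \<one>"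
  shows "a \<otimes> b = b \<otimes> a"
proof -
  have "a \<otimes> b \<otimes> inv a = b"
    using assms by (metis inv_closed inv_equality inv_inv m_closed)
  then show ?thesis
    using a b by (metis inv_solve_right m_closed)
qed

text \<open>Three points are moved into place one after the other; since the targets are distinct, no
  later transposition disturbs a point that is already placed.\<close>

lemma ex_permutes_triple:
  assumes "distinct [a, b, c]" "distinct [a', b', c']" "{a, b, c, a', b', c'} \<subseteq> S"
  shows "\<exists>p. p permutes S \<and> p a = a' \<and> p b = b' \<and> p c = c'"
proof -
  define p1 where "p1 = transpose a a'"
  define p2 where "p2 = transpose (p1 b) b' \<circ> p1"
  define p3 where "p3 = transpose (p2 c) c' \<circ> p2"
  have 1: "p1 permutes S" "p1 a = a'"
    using assms by (auto simp: p1_def intro: permutes_swap_id)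
  have "p1 b \<noteq> a'" "p1 b \<in> S"
    using assms 1 by (auto simp: p1_def transpose_def)
  then have 2: "p2 permutes S" "p2 a = a'" "p2 b = b'"
    using assms 1 by (auto simp: p2_def intro!: permutes_swap_id permutes_compose)
  have "p2 c \<noteq> p2 a" "p2 c \<noteq> p2 b"
    using assms(1) permutes_inj[OF 2(1)] by (auto dest: injD)
  moreover have "p2 c \<in> S"
    using assms 2 by (auto simp: permutes_in_image)
  ultimately have "p3 permutes S" "p3 a = a'" "p3 b = b'" "p3 c = c'"
    using assms 2 by (auto simp: p3_def intro!: permutes_swap_id permutes_compose)
  then show ?thesis by blast
qed

section \<open>Involutions satisfying the braid relations\<close>

text \<open>The hypotheses say that \<open>r\<close> extends to a homomorphism from the symmetric group on \<open>n\<close> points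
  to \<open>G\<close>, but they are used in this relational form, so that the Coxeter presentation of the
  symmetric group need not be established.\<close>

locale coxeter_images = group G for G :: "('a, 'b) monoid_scheme" (structure) +
  fixes r :: "nat \<Rightarrow> 'a" and n :: nat
  assumes r_closed [simp]: "1 \<le> i \<Longrightarrow> i < n \<Longrightarrow> r i \<in> carrier G"
    and r_invol: "1 \<le> i \<Longrightarrow> i < n \<Longrightarrow> r i \<otimes> r i = \<one>"
    and r_braid: "1 \<le> i \<Longrightarrow> Suc i < n \<Longrightarrow> r i \<otimes> r (Suc i) \<otimes> r i = r (Suc i) \<otimes> r i \<otimes> r (Suc i)"
    and r_far: "1 \<le> i \<Longrightarrow> Suc (Suc i) \<le> j \<Longrightarrow> j < n \<Longrightarrow> r i \<otimes> r j = r j \<otimes> r i"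
begin

lemma r_cancel [simp]: "1 \<le> i \<Longrightarrow> i < n \<Longrightarrow> z \<in> carrier G \<Longrightarrow> r i \<otimes> (r i \<otimes> z) = z"
  by (simp flip: m_assoc add: r_invol)

lemma commuting_neighbours_equal:
  assumes i: "1 \<le> i" "Suc i < n" and comm: "r i \<otimes> r (Suc i) = r (Suc i) \<otimes> r i"
  shows "r i = r (Suc i)"
proof -
  have "r (Suc i) = r i \<otimes> r (Suc i) \<otimes> r i"
    using i comm by (simp add: m_assoc r_invol)
  also have "\<dots> = r (Suc i) \<otimes> r i \<otimes> r (Suc i)"
    using i by (simp add: r_braid)
  also have "\<dots> = r i"
    using i comm by (simp flip: comm add: m_assoc r_invol)
  finally show ?thesis by simp
qed

text \<open>An equality of two neighbours spreads in both directions: the next generator is far from one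
  of the two equal ones, hence commutes with the other one, which is its neighbour.\<close>

lemma r_collapse:
  assumes m: "1 \<le> m" "Suc m < n" "r m = r (Suc m)" and i: "1 \<le> i" "i < n"
  shows "r i = r 1"
proof -
  have down: "1 \<le> j \<Longrightarrow> Suc j < n \<Longrightarrow> r j = r (Suc j) \<Longrightarrow> r 1 = r 2" for j
  proof (induction j)
    case (Suc j)
    show ?case
    proof (cases "j = 0")
      case False
      have "r j \<otimes> r (Suc j) = r (Suc j) \<otimes> r j"
        using r_far[of j "Suc (Suc j)"] Suc.prems False by simp
      then show ?thesis
        using Suc False commuting_neighbours_equal[of j] by auto
    qed (use Suc in \<open>simp add: numeral_2_eq_2\<close>)
  qed simp
  have "r (Suc j) = r 1 \<and> (Suc (Suc j) < n \<longrightarrow> r (Suc (Suc j)) = r 1)" if "Suc j < n" for j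
    using that
  proof (induction j)
    case 0
    then show ?case using down[OF m] by (simp add: numeral_2_eq_2)
  next
    case (Suc j)
    have "r (Suc (Suc j)) = r (Suc (Suc (Suc j)))" if lt: "Suc (Suc (Suc j)) < n"
    proof (rule commuting_neighbours_equal)
      show "r (Suc (Suc j)) \<otimes> r (Suc (Suc (Suc j))) = r (Suc (Suc (Suc j))) \<otimes> r (Suc (Suc j))"
        using r_far[of "Suc j" "Suc (Suc (Suc j))"] Suc lt by simp
    qed (use lt in auto)
    then show ?case using Suc by auto
  qed
  from this[of "i - 1"] show ?thesis using i by simp
qed

text \<open>In terms of permutations \<open>r 1 \<otimes> r 2\<close> and \<open>r 3 \<otimes> r 4\<close> are 3-cycles with exactly one common
  point. In the equation that makes them commute \<open>r 4\<close> cancels, being far from \<open>r 1\<close> and \<open>r 2\<close>, and then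
  \<open>r 1\<close> cancels, being far from \<open>r 3\<close>. What is left says that \<open>r 2\<close> and \<open>r 3\<close> commute.\<close>

lemma r_collapse_if_cycles_commute:
  assumes n: "n \<ge> 5"
    and comm: "(r 1 \<otimes> r 2) \<otimes> (r 3 \<otimes> r 4) = (r 3 \<otimes> r 4) \<otimes> (r 1 \<otimes> r 2)"
    and i: "1 \<le> i" "i < n"
  shows "r i = r 1"
proof -
  have cl: "r 1 \<in> carrier G" "r 2 \<in> carrier G" "r 3 \<in> carrier G" "r 4 \<in> carrier G"
    using n by auto
  have "r 4 \<otimes> (r 1 \<otimes> r 2) = (r 1 \<otimes> r 2) \<otimes> r 4"
  proof -
    have "r 1 \<otimes> r 4 = r 4 \<otimes> r 1" "r 2 \<otimes> r 4 = r 4 \<otimes> r 2"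
      using n by (auto intro: r_far)
    then show ?thesis using cl by (metis m_assoc)
  qed
  then have "(r 1 \<otimes> r 2 \<otimes> r 3) \<otimes> r 4 = (r 3 \<otimes> r 1 \<otimes> r 2) \<otimes> r 4"
    using comm cl by (simp add: m_assoc)
  then have "r 1 \<otimes> r 2 \<otimes> r 3 = r 3 \<otimes> r 1 \<otimes> r 2"
    using cl by simp
  also have "r 3 \<otimes> r 1 = r 1 \<otimes> r 3"
    using n r_far[of 1 3] by simp
  finally have "r 2 \<otimes> r 3 = r 3 \<otimes> r 2"
    using cl by (simp add: m_assoc)
  then have "r 2 = r 3"
    using commuting_neighbours_equal[of 2] n by (simp add: eval_nat_numeral)
  then show ?thesis
    using r_collapse[of 2 i] i n by (simp add: eval_nat_numeral)
qed

text \<open>\<open>r i \<otimes> r (Suc i)\<close> has order dividing 3, so it equals the square of its inverse, and the square of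
  a product of two involutions is their commutator.\<close>

lemma r_neighbours_commutator:
  assumes "1 \<le> i" "Suc i < n"
  shows "r i \<otimes> r (Suc i) = r (Suc i) \<otimes> r i \<otimes> inv (r (Suc i)) \<otimes> inv (r i)"
proof -
  have "inv (r i) = r i" "inv (r (Suc i)) = r (Suc i)"
    using assms by (simp_all add: inv_equality r_invol)
  moreover have "r (Suc i) \<otimes> r i \<otimes> r (Suc i) \<otimes> r i = r i \<otimes> r (Suc i) \<otimes> r i \<otimes> r i"
    using assms by (simp add: r_braid)
  ultimately show ?thesis
    using assms by (simp add: m_assoc r_invol)
qed

text \<open>If commutators commute, then so do the two 3-cycles above, which are commutators
  themselves.\<close>

lemma r_collapse_if_metabelian:
  assumes n: "n \<ge> 5" and metabelian: "derived G (derived G (carrier G)) \<subseteq> {\<one>}"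
    and i: "1 \<le> i" "i < n"
  shows "r i = r 1"
proof (rule r_collapse_if_cycles_commute[OF n _ i])
  have cycle: "r i \<otimes> r j \<in> derived G (carrier G)" if "1 \<le> i" "j = Suc i" "j < n" for i j
    using r_neighbours_commutator[of i] commutator_in_derived[of "r j" "carrier G" "r i"] that
    by simp
  have "r 1 \<otimes> r 2 \<in> derived G (carrier G)" "r 3 \<otimes> r 4 \<in> derived G (carrier G)"
    by (rule cycle; use n in simp)+
  moreover from this have "r 1 \<otimes> r 2 \<in> carrier G" "r 3 \<otimes> r 4 \<in> carrier G"
    using derived_in_carrier[of "carrier G"] by auto
  ultimately show "(r 1 \<otimes> r 2) \<otimes> (r 3 \<otimes> r 4) = (r 3 \<otimes> r 4) \<otimes> (r 1 \<otimes> r 2)"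
    using commutator_in_derived metabelian by (blast intro: commute_if_commutator_trivial)
qed

section \<open>The images of the transpositions\<close>

text \<open>As \<open>r k\<close> is an involution, this is conjugation by \<open>r k\<close>.\<close>

definition cj :: "nat \<Rightarrow> 'a \<Rightarrow> 'a" where
  "cj k z = r k \<otimes> z \<otimes> r k"

lemma cj_closed [simp]: "1 \<le> k \<Longrightarrow> k < n \<Longrightarrow> z \<in> carrier G \<Longrightarrow> cj k z \<in> carrier G"
  by (simp add: cj_def)

lemma cj_cj [simp]: "1 \<le> k \<Longrightarrow> k < n \<Longrightarrow> z \<in> carrier G \<Longrightarrow> cj k (cj k z) = z"
  by (simp add: cj_def m_assoc r_invol)

lemma cj_self [simp]: "1 \<le> k \<Longrightarrow> k < n \<Longrightarrow> cj k (r k) = r k"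
  by (simp add: cj_def m_assoc)

lemma cj_braid:
  assumes "1 \<le> k" "Suc k < n" "z \<in> carrier G"
  shows "cj k (cj (Suc k) (cj k z)) = cj (Suc k) (cj k (cj (Suc k) z))"
proof -
  have "cj k (cj (Suc k) (cj k z)) =
      (r k \<otimes> r (Suc k) \<otimes> r k) \<otimes> z \<otimes> (r k \<otimes> r (Suc k) \<otimes> r k)"
    using assms by (simp add: cj_def m_assoc)
  also have "\<dots> = cj (Suc k) (cj k (cj (Suc k) z))"
    using assms by (simp add: r_braid) (simp add: cj_def m_assoc)
  finally show ?thesis .
qed

lemma cj_far:
  assumes "1 \<le> i" "Suc (Suc i) \<le> j" "j < n" "z \<in> carrier G"
  shows "cj i (cj j z) = cj j (cj i z)"
proof -
  have "cj i (cj j z) = (r i \<otimes> r j) \<otimes> z \<otimes> (r j \<otimes> r i)"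
    using assms by (simp add: cj_def m_assoc)
  also have "\<dots> = (r j \<otimes> r i) \<otimes> z \<otimes> (r i \<otimes> r j)"
    by (simp only: r_far[OF assms(1-3)])
  also have "\<dots> = cj j (cj i z)"
    using assms by (simp add: cj_def m_assoc)
  finally show ?thesis .
qed

lemma cj_r_braid: "1 \<le> k \<Longrightarrow> Suc k < n \<Longrightarrow> cj k (r (Suc k)) = cj (Suc k) (r k)"
  by (simp add: cj_def r_braid)

lemma cj_r_far:
  assumes "1 \<le> i" "Suc (Suc i) \<le> j" "j < n"
  shows "cj i (r j) = r j" "cj j (r i) = r i"
proof -
  show "cj i (r j) = r j"
    using assms r_far[OF assms] by (simp add: cj_def m_assoc flip: r_far[OF assms])
  show "cj j (r i) = r i"
    using assms r_far[OF assms] by (simp add: cj_def m_assoc)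
qed

text \<open>For \<open>i < j\<close>, the image of the transposition of \<open>i\<close> and \<open>j\<close>, obtained from \<open>r i\<close> by moving the
  upper point from \<open>i + 1\<close> to \<open>j\<close> one step at a time. The values for \<open>j \<le> i\<close> carry no meaning.\<close>

fun rise :: "nat \<Rightarrow> nat \<Rightarrow> 'a" where
  "rise i 0 = \<one>"
| "rise i (Suc j) = (if i = j then r i else cj j (rise i j))"

definition refl_elt :: "nat \<Rightarrow> nat \<Rightarrow> 'a" where
  "refl_elt i j = rise (min i j) (max i j)"

lemma refl_elt_sym: "refl_elt i j = refl_elt j i"
  by (simp add: refl_elt_def min.commute max.commute)

lemma refl_elt_adjacent: "refl_elt i (Suc i) = r i"
  by (simp add: refl_elt_def)

lemma refl_elt_Suc: "i < j \<Longrightarrow> refl_elt i (Suc j) = cj j (refl_elt i j)"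
  by (simp add: refl_elt_def)

lemma refl_elt_closed: "1 \<le> i \<Longrightarrow> i < j \<Longrightarrow> j \<le> n \<Longrightarrow> refl_elt i j \<in> carrier G"
  by (induction j) (auto simp: less_Suc_eq refl_elt_Suc refl_elt_adjacent)

text \<open>The next four lemmas show that \<open>r k\<close> acts on the \<open>refl_elt i j\<close> through the indices; they
  follow the position of \<open>k\<close> and \<open>k + 1\<close> relative to \<open>i < j\<close>. Outside of \<open>[i, j]\<close> all factors that build up
  \<open>refl_elt i j\<close> commute with \<open>r k\<close>.\<close>

lemma cj_refl_elt_far:
  assumes "1 \<le> k" "k < n" "1 \<le> i" "i < j" "j \<le> n" "j < k \<or> Suc k < i"
  shows "cj k (refl_elt i j) = refl_elt i j"
  using assms
proof (induction j)
  case (Suc j)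
  show ?case
  proof (cases "i = j")
    case True
    then show ?thesis using Suc.prems by (auto simp: refl_elt_adjacent cj_r_far)
  next
    case False
    have cl: "refl_elt i j \<in> carrier G"
      using Suc.prems False by (auto intro: refl_elt_closed)
    have "cj k (cj j (refl_elt i j)) = cj j (cj k (refl_elt i j))"
      using Suc.prems False cl cj_far[of k j] cj_far[of j k] by auto
    then show ?thesis
      using Suc False by (auto simp: refl_elt_Suc)
  qed
qed simp

lemma cj_refl_elt_below:
  assumes "1 \<le> k" "Suc k < j" "j \<le> n"
  shows "cj k (refl_elt (Suc k) j) = refl_elt k j"
  using assms
proof (induction j)
  case (Suc j)
  show ?case
  proof (cases "j = Suc k")
    case True
    then show ?thesis
      using Suc.prems by (simp add: refl_elt_adjacent refl_elt_Suc cj_r_braid)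
  next
    case False
    have cl: "refl_elt (Suc k) j \<in> carrier G"
      using Suc.prems False by (auto intro: refl_elt_closed)
    have "cj k (cj j (refl_elt (Suc k) j)) = cj j (cj k (refl_elt (Suc k) j))"
      using Suc.prems False cl by (intro cj_far) auto
    then show ?thesis
      using Suc False by (auto simp: refl_elt_Suc)
  qed
qed simp

text \<open>When the upper point moves past \<open>k\<close> and \<open>k + 1\<close>, it is conjugated by \<open>r k\<close> and then by
  \<open>r (k + 1)\<close>. The braid relation turns an additional conjugation by \<open>r k\<close> into one by \<open>r (k + 1)\<close> that is
  applied first, and that one has no effect since \<open>k + 1\<close> is still beyond the upper point.\<close>

lemma cj_refl_elt_inside:
  assumes "1 \<le> i" "i < k" "Suc k < j" "j \<le> n"
  shows "cj k (refl_elt i j) = refl_elt i j"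
  using assms
proof (induction j)
  case (Suc j)
  show ?case
  proof (cases "j = Suc k")
    case True
    have cl: "refl_elt i k \<in> carrier G"
      using Suc.prems by (auto intro: refl_elt_closed)
    have "cj k (refl_elt i (Suc j)) = cj k (cj (Suc k) (cj k (refl_elt i k)))"
      using Suc.prems True by (simp add: refl_elt_Suc)
    also have "\<dots> = cj (Suc k) (cj k (cj (Suc k) (refl_elt i k)))"
      using Suc.prems True cl by (intro cj_braid) auto
    also have "cj (Suc k) (refl_elt i k) = refl_elt i k"
      using Suc.prems True by (intro cj_refl_elt_far) auto
    finally show ?thesis
      using Suc.prems True by (simp add: refl_elt_Suc)
  next
    case False
    have cl: "refl_elt i j \<in> carrier G"
      using Suc.prems False by (auto intro: refl_elt_closed)
    have "cj k (cj j (refl_elt i j)) = cj j (cj k (refl_elt i j))"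
      using Suc.prems False cl by (intro cj_far) auto
    then show ?thesis
      using Suc False by (auto simp: refl_elt_Suc)
  qed
qed simp

lemma cj_refl_elt:
  assumes k: "1 \<le> k" "k < n" and ij: "i \<in> {1..n}" "j \<in> {1..n}" "i \<noteq> j"
  shows "cj k (refl_elt i j) = refl_elt (transpose k (Suc k) i) (transpose k (Suc k) j)"
proof -
  have less: "cj k (refl_elt i j) = refl_elt (transpose k (Suc k) i) (transpose k (Suc k) j)"
    if ij: "1 \<le> i" "i < j" "j \<le> n" for i j
  proof -
    have cl: "refl_elt i j \<in> carrier G"
      using ij by (rule refl_elt_closed)
    consider "j < k \<or> Suc k < i" | "i = Suc k" | "i = k" "j = Suc k" | "i = k" "Suc k < j"
      | "j = k" | "j = Suc k" "i < k" | "i < k" "Suc k < j"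
      using ij by linarith
    then show ?thesis
    proof cases
      case 1
      then show ?thesis
        using ij k cj_refl_elt_far[of k i j] by (auto simp: transpose_def)
    next
      case 2
      then show ?thesis
        using ij k cj_refl_elt_below[of k j] by (auto simp: transpose_def)
    next
      case 3
      then show ?thesis
        using k by (simp add: refl_elt_adjacent refl_elt_sym[of "Suc k" k])
    next
      case 4
      have "refl_elt (Suc k) j \<in> carrier G"
        using ij 4 by (intro refl_elt_closed) auto
      then show ?thesis
        using ij k 4 by (auto simp: transpose_def simp flip: cj_refl_elt_below)
    next
      case 5
      then show ?thesis
        using ij k by (auto simp: transpose_def refl_elt_Suc)
    next
      case 6
      then have "refl_elt i k \<in> carrier G"
        using ij k by (intro refl_elt_closed) auto
      then show ?thesis
        using ij k 6 by (auto simp: transpose_def refl_elt_Suc)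
    next
      case 7
      then show ?thesis
        using ij k cj_refl_elt_inside[of i k j] by (auto simp: transpose_def)
    qed
  qed
  show ?thesis
    using less[of i j] less[of j i] ij
      refl_elt_sym[of i j] refl_elt_sym[of "transpose k (Suc k) i" "transpose k (Suc k) j"]
    by (cases "i < j") auto
qed

text \<open>Permutations that are realised by a conjugation are closed under composition, so the
  adjacent transpositions suffice.\<close>

lemma ex_conjugator:
  assumes "p permutes {1..n}"
  shows "\<exists>g\<in>carrier G. \<forall>i\<in>{1..n}. \<forall>j\<in>{1..n}. i \<noteq> j \<longrightarrow>
    g \<otimes> refl_elt i j \<otimes> inv g = refl_elt (p i) (p j)"
  using assms
proof (induction rule: adjacent_transpositions_induct)
  case id
  have "refl_elt i j \<in> carrier G" if "i \<in> {1..n}" "j \<in> {1..n}" "i \<noteq> j" for i j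
    using that refl_elt_closed[of i j] refl_elt_closed[of j i] refl_elt_sym[of i j]
    by (cases "i < j") auto
  then show ?case by (intro bexI[of _ \<one>]) auto
next
  case (adjacent k)
  have "inv (r k) = r k"
    using adjacent by (simp add: inv_equality r_invol)
  then show ?case
    using adjacent cj_refl_elt[of k] by (intro bexI[of _ "r k"]) (auto simp: cj_def)
next
  case (comp p q)
  obtain g where g: "g \<in> carrier G"
    and g_act: "\<forall>i\<in>{1..n}. \<forall>j\<in>{1..n}. i \<noteq> j \<longrightarrow>
      g \<otimes> refl_elt i j \<otimes> inv g = refl_elt (p i) (p j)"
    using comp.IH(1) by (rule bexE)
  obtain h where h: "h \<in> carrier G"
    and h_act: "\<forall>i\<in>{1..n}. \<forall>j\<in>{1..n}. i \<noteq> j \<longrightarrow>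
      h \<otimes> refl_elt i j \<otimes> inv h = refl_elt (q i) (q j)"
    using comp.IH(2) by (rule bexE)
  show ?case
  proof (intro bexI[of _ "g \<otimes> h"] ballI impI)
    fix i j assume ij: "i \<in> {1..n}" "j \<in> {1..n}" "i \<noteq> j"
    have cl: "refl_elt i j \<in> carrier G"
      using ij refl_elt_closed[of i j] refl_elt_closed[of j i] refl_elt_sym[of i j]
      by (cases "i < j") auto
    have "(g \<otimes> h) \<otimes> refl_elt i j \<otimes> inv (g \<otimes> h) = g \<otimes> (h \<otimes> refl_elt i j \<otimes> inv h) \<otimes> inv g"
      using cl g h by (simp add: m_assoc inv_mult_group)
    also have "\<dots> = refl_elt (p (q i)) (p (q j))"
    proof -
      have "q i \<in> {1..n}" "q j \<in> {1..n}" "q i \<noteq> q j"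
        using ij permutes_in_image[OF comp.hyps(2)] injD[OF permutes_inj[OF comp.hyps(2)], of i j]
        by blast+
      then have "g \<otimes> refl_elt (q i) (q j) \<otimes> inv g = refl_elt (p (q i)) (p (q j))"
        using g_act by blast
      moreover have "h \<otimes> refl_elt i j \<otimes> inv h = refl_elt (q i) (q j)"
        using h_act ij by blast
      ultimately show ?thesis by (simp only:)
    qed
    finally show "(g \<otimes> h) \<otimes> refl_elt i j \<otimes> inv (g \<otimes> h) = refl_elt ((p \<circ> q) i) ((p \<circ> q) j)"
      by simp
  qed (use g h in auto)
qed

lemma refl_elt_permute:
  assumes "p permutes {1..n}" "refl_elt i j = refl_elt k l"
    and "{i, j, k, l} \<subseteq> {1..n}" "i \<noteq> j" "k \<noteq> l"
  shows "refl_elt (p i) (p j) = refl_elt (p k) (p l)"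
proof -
  obtain g where "\<forall>i\<in>{1..n}. \<forall>j\<in>{1..n}. i \<noteq> j \<longrightarrow>
      g \<otimes> refl_elt i j \<otimes> inv g = refl_elt (p i) (p j)"
    using ex_conjugator[OF assms(1)] by blast
  then have "refl_elt (p i) (p j) = g \<otimes> refl_elt i j \<otimes> inv g"
      "refl_elt (p k) (p l) = g \<otimes> refl_elt k l \<otimes> inv g"
    using assms(3-) by simp_all
  then show ?thesis using assms(2) by simp
qed

text \<open>The permutations act transitively on pairs of transpositions with one common point, so
  a single coincidence in this orbit forces the coincidence of \<open>r 1\<close> and \<open>r 2\<close>.\<close>

lemma refl_elt_shared_point_distinct:
  assumes ne: "r 1 \<noteq> r 2" and ijl: "{i, j, l} \<subseteq> {1..n}" "distinct [i, j, l]"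
  shows "refl_elt i j \<noteq> refl_elt i l"
proof
  assume eq: "refl_elt i j = refl_elt i l"
  have "card {i, j, l} \<le> card {1..n}"
    using ijl by (intro card_mono) auto
  then have n: "n \<ge> 3"
    using ijl by simp
  then obtain p where p: "p permutes {1..n}" "p i = 2" "p j = 1" "p l = 3"
    using ijl ex_permutes_triple[of i j l 2 1 3 "{1..n}"] by auto
  have "refl_elt 2 1 = refl_elt 2 3"
    using refl_elt_permute[OF p(1) eq] p ijl by auto
  then show False
    using ne refl_elt_adjacent[of 1] refl_elt_adjacent[of 2] refl_elt_sym[of 2 1]
    by (simp add: eval_nat_numeral)
qed

text \<open>A coincidence of disjoint transpositions \<open>(i j)\<close> and \<open>(k l)\<close> is reduced to the case of a common
  point: a fifth point \<open>m\<close> allows replacing \<open>l\<close> by \<open>m\<close> while fixing \<open>i\<close>, \<open>j\<close> and \<open>k\<close>, whence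
  \<open>(k l)\<close> and \<open>(k m)\<close> coincide. With four points this fails, as the quotient of the symmetric group on 4
  points by the Klein four-group shows.\<close>

lemma refl_elt_distinct:
  assumes n: "n \<ge> 5" and ne: "r 1 \<noteq> r 2"
    and pts: "{i, j, k, l} \<subseteq> {1..n}" "i \<noteq> j" "k \<noteq> l" and eq: "refl_elt i j = refl_elt k l"
  shows "{i, j} = {k, l}"
proof (cases "{i, j} \<inter> {k, l} = {}")
  case True
  have "card {i, j, k, l} = 4"
    using True pts by auto
  then have "\<not> {1..n} \<subseteq> {i, j, k, l}"
    using n card_mono[of "{i, j, k, l}" "{1..n}"] by auto
  then obtain m where m: "m \<in> {1..n}" "m \<notin> {i, j, k, l}"
    by blast
  have "transpose l m permutes {1..n}"
    using m pts by (intro permutes_swap_id) auto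
  from refl_elt_permute[OF this eq] have "refl_elt i j = refl_elt k m"
    using True pts m by (auto simp: transpose_def split: if_splits)
  then show ?thesis
    using eq refl_elt_shared_point_distinct[OF ne, of k l m] pts m by auto
next
  case False
  show ?thesis
  proof (rule ccontr)
    assume neq: "{i, j} \<noteq> {k, l}"
    consider "i = k" | "i = l" | "j = k" | "j = l"
      using False by blast
    then show False
    proof cases
      case 1
      then show False
        using refl_elt_shared_point_distinct[OF ne, of i j l] eq neq pts by auto
    next
      case 2
      then show False
        using refl_elt_shared_point_distinct[OF ne, of i j k] eq neq pts refl_elt_sym[of k l] by auto
    next
      case 3
      then show False
        using refl_elt_shared_point_distinct[OF ne, of j i l] eq neq pts refl_elt_sym[of i j] by auto
    next
      case 4
      then show False
        using refl_elt_shared_point_distinct[OF ne, of j i k] eq neq pts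
          refl_elt_sym[of i j] refl_elt_sym[of k l] by auto
    qed
  qed
qed

text \<open>A conjugator of \<open>p\<close> determines the pairs \<open>{p i, p j}\<close>, and with a third point \<open>l\<close> it determines
  \<open>p i\<close> as the common element of \<open>{p i, p j}\<close> and \<open>{p i, p l}\<close>. So different permutations have different
  conjugators.\<close>

theorem fact_le_order:
  assumes n: "n \<ge> 5" and fin: "finite (carrier G)" and ne: "r 1 \<noteq> r 2"
  shows "fact n \<le> order G"
proof -
  obtain g where g: "\<And>p. p permutes {1..n} \<Longrightarrow> g p \<in> carrier G"
    and act: "\<And>p i j. p permutes {1..n} \<Longrightarrow> i \<in> {1..n} \<Longrightarrow> j \<in> {1..n} \<Longrightarrow> i \<noteq> j \<Longrightarrow>
      g p \<otimes> refl_elt i j \<otimes> inv (g p) = refl_elt (p i) (p j)"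
    using ex_conjugator by metis
  have "inj_on g {p. p permutes {1..n}}"
  proof (rule inj_onI, clarify)
    fix p q assume p: "p permutes {1..n}" and q: "q permutes {1..n}" and gpq: "g p = g q"
    have pair: "{p i, p j} = {q i, q j}" if ij: "i \<in> {1..n}" "j \<in> {1..n}" "i \<noteq> j" for i j
    proof (rule refl_elt_distinct[OF n ne])
      show "{p i, p j, q i, q j} \<subseteq> {1..n}"
        using ij permutes_in_image[OF p] permutes_in_image[OF q] by auto
      show "p i \<noteq> p j" "q i \<noteq> q j"
        using ij permutes_inj[OF p] permutes_inj[OF q] by (auto simp: inj_eq)
      show "refl_elt (p i) (p j) = refl_elt (q i) (q j)"
        using act[OF p ij] act[OF q ij] gpq by simp
    qed
    have "p i = q i" if i: "i \<in> {1..n}" for i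
    proof -
      have "\<not> {1..n} \<subseteq> {i}"
        using n card_mono[of "{i}" "{1..n}"] by auto
      then obtain j where j: "j \<in> {1..n}" "j \<noteq> i" by blast
      have "\<not> {1..n} \<subseteq> {i, j}"
        using n card_mono[of "{i, j}" "{1..n}"] j by auto
      then obtain l where l: "l \<in> {1..n}" "l \<noteq> i" "l \<noteq> j" by blast
      have "p j \<noteq> p l" "q j \<noteq> q l"
        using l permutes_inj[OF p] permutes_inj[OF q] by (auto simp: inj_eq)
      then show ?thesis
        using pair[of i j] pair[of i l] i j l by (auto simp: doubleton_eq_iff)
    qed
    moreover have "p i = q i" if "i \<notin> {1..n}" for i
      using that p q by (metis permutes_not_in)
    ultimately show "p = q" by blast
  qed
  then have "card {p. p permutes {1..n}} \<le> card (carrier G)"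
    using fin g by (intro card_inj_on_le) auto
  then show ?thesis
    by (simp add: order_def card_permutations)
qed

end

section \<open>Words and the universal property of a presentation\<close>

definition letter_val :: "('h, 'm) monoid_scheme \<Rightarrow> ('g \<Rightarrow> 'h) \<Rightarrow> 'g \<times> bool \<Rightarrow> 'h" where
  "letter_val H f a = (if snd a then f (fst a) else inv\<^bsub>H\<^esub> f (fst a))"

definition word_val :: "('h, 'm) monoid_scheme \<Rightarrow> ('g \<Rightarrow> 'h) \<Rightarrow> 'g gword \<Rightarrow> 'h" where
  "word_val H f w = foldr (\<lambda>a z. letter_val H f a \<otimes>\<^bsub>H\<^esub> z) w \<one>\<^bsub>H\<^esub>"

lemma word_val_simps [simp]:
  "word_val H f [] = \<one>\<^bsub>H\<^esub>"
  "word_val H f (a # w) = letter_val H f a \<otimes>\<^bsub>H\<^esub> word_val H f w"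
  by (simp_all add: word_val_def)

lemma poswd_simps [simp]: "poswd [] = []" "poswd (x # xs) = (x, True) # poswd xs"
  by (simp_all add: poswd_def)

lemma poswd_in_gwords_iff: "poswd xs \<in> gwords X \<longleftrightarrow> set xs \<subseteq> X"
  by (induction xs) auto

lemma word_val_map_poswd:
  "word_val H f (poswd (map g xs)) = word_val H (f \<circ> g) (poswd xs)"
  by (induction xs) (simp_all add: letter_val_def)

context group
begin

lemma letter_val_closed [simp]: "f ` X \<subseteq> carrier G \<Longrightarrow> fst a \<in> X \<Longrightarrow> letter_val G f a \<in> carrier G"
  by (auto simp: letter_val_def)

lemma word_val_closed [simp]: "f ` X \<subseteq> carrier G \<Longrightarrow> w \<in> gwords X \<Longrightarrow> word_val G f w \<in> carrier G"
  by (induction w) auto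

lemma word_val_append:
  assumes f: "f ` X \<subseteq> carrier G" and "v \<in> gwords X" "w \<in> gwords X"
  shows "word_val G f (v @ w) = word_val G f v \<otimes> word_val G f w"
  using assms(2,3)
proof (induction v)
  case Nil
  then show ?case using word_val_closed[OF f] by simp
next
  case (Cons a v)
  then show ?case using letter_val_closed[OF f, of a] word_val_closed[OF f] by (simp add: m_assoc)
qed

lemma word_val_commute:
  assumes f: "f ` X \<subseteq> carrier G" and z: "z \<in> carrier G"
    and comm: "\<And>x. x \<in> X \<Longrightarrow> z \<otimes> f x = f x \<otimes> z" and w: "w \<in> gwords X"
  shows "z \<otimes> word_val G f w = word_val G f w \<otimes> z"
  using w
proof (induction w)
  case (Cons a w)
  have cl: "letter_val G f a \<in> carrier G" "word_val G f w \<in> carrier G" "f (fst a) \<in> carrier G"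
    using Cons.prems f by (auto intro: letter_val_closed[OF f] word_val_closed[OF f])
  have "z \<otimes> inv f (fst a) = inv f (fst a) \<otimes> z"
    using comm[of "fst a"] Cons.prems cl z
    by (metis gwords_simps(3) inv_closed inv_solve_left inv_solve_right' m_assoc m_closed)
  then have "z \<otimes> letter_val G f a = letter_val G f a \<otimes> z"
    using comm Cons.prems by (simp add: letter_val_def)
  then show ?case
    using Cons cl z by (simp flip: m_assoc) (simp add: m_assoc)
qed (use z in simp)

lemma word_vals_commute:
  assumes f: "f ` X \<subseteq> carrier G"
    and comm: "\<And>x y. x \<in> X \<Longrightarrow> y \<in> X \<Longrightarrow> f x \<otimes> f y = f y \<otimes> f x"
    and v: "v \<in> gwords X" and w: "w \<in> gwords X"
  shows "word_val G f v \<otimes> word_val G f w = word_val G f w \<otimes> word_val G f v"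
proof (rule word_val_commute[OF f _ _ w])
  show "word_val G f v \<in> carrier G"
    using f v by (rule word_val_closed)
  show "word_val G f v \<otimes> f x = f x \<otimes> word_val G f v" if "x \<in> X" for x
    using that word_val_commute[OF f _ _ v, of "f x"] comm f by auto
qed

text \<open>Evaluation respects the congruence generated by the relations; this makes it well defined on
  the presented group.\<close>

lemma word_val_pres_rel:
  assumes f: "f ` X \<subseteq> carrier G"
    and rels: "\<And>l r. (l, r) \<in> R \<Longrightarrow> l \<in> gwords X \<Longrightarrow> r \<in> gwords X \<Longrightarrow> word_val G f l = word_val G f r"
    and "(v, w) \<in> pres_rel X R"
  shows "word_val G f v = word_val G f w"
  using assms(3)
proof (induction rule: pres_rel.induct)
  case (cancel u v x b)
  have x: "f x \<in> carrier G" using cancel f by auto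
  have v: "word_val G f v \<in> carrier G" using cancel word_val_closed[OF f] by simp
  have "word_val G f ([(x, b), (x, \<not> b)] @ v) = word_val G f v"
    using x v by (cases b) (simp_all add: letter_val_def flip: m_assoc)
  then show ?case
    using cancel by (simp add: word_val_append[OF f] del: append_Cons)
next
  case (relator u v l r)
  then show ?case
    using rels[of l r] by (simp add: word_val_append[OF f])
qed simp_all

end

lemma word_val_hom:
  assumes "group_hom G H h" and f: "f ` X \<subseteq> carrier G" and "w \<in> gwords X"
  shows "h (word_val G f w) = word_val H (h \<circ> f) w"
proof -
  interpret group_hom G H h by fact
  show ?thesis
    using assms(3)
  proof (induction w)
    case (Cons a w)
    have "f (fst a) \<in> carrier G" "word_val G f w \<in> carrier G" "letter_val G f a \<in> carrier G"
      using Cons.prems f by (auto intro: G.letter_val_closed[OF f] G.word_val_closed[OF f])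
    then show ?case using Cons by (auto simp: letter_val_def)
  qed simp
qed

definition pres_gen :: "'g set \<Rightarrow> ('g gword \<times> 'g gword) set \<Rightarrow> 'g \<Rightarrow> 'g gword set" where
  "pres_gen X R x = pres_rel X R `` {[(x, True)]}"

lemma pres_gen_closed: "pres_gen X R ` X \<subseteq> carrier (presented_group X R)"
  by (auto simp: pres_gen_def presented_group_carrier_iff intro!: bexI[of _ "[(_, True)]"])

lemma presented_group_one: "\<one>\<^bsub>presented_group X R\<^esub> = pres_rel X R `` {[]}"
  by (simp add: presented_group_def)

text \<open>This reduces claims about elements of the presented group to claims about generators: every
  element is the value of a word in them.\<close>

lemma presented_group_class_eq_word_val:
  assumes "w \<in> gwords X"
  shows "pres_rel X R `` {w} = word_val (presented_group X R) (pres_gen X R) w"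
  using assms
proof (induction w)
  case Nil
  then show ?case by (simp add: presented_group_one)
next
  case (Cons a w)
  interpret P: group "presented_group X R" by (rule group_presented_group)
  obtain x b where a: "a = (x, b)" "x \<in> X" using Cons.prems by (cases a) auto
  have "pres_rel X R `` {[(x, False)]} = inv\<^bsub>presented_group X R\<^esub> pres_gen X R x"
  proof (rule P.inv_equality[symmetric])
    have "([(x, False), (x, True)], []) \<in> pres_rel X R"
      using pres_rel.cancel[of "[]" X "[]" x False R] a by simp
    then have "pres_rel X R `` {[(x, False), (x, True)]} = pres_rel X R `` {[]}"
      by (rule equiv_class_eq[OF equiv_pres_rel])
    moreover have "pres_rel X R `` {[(x, False)]} \<otimes>\<^bsub>presented_group X R\<^esub> pres_gen X R x =
        pres_rel X R `` {[(x, False)] @ [(x, True)]}"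
      unfolding pres_gen_def using a by (intro presented_group_mult) simp_all
    ultimately show "pres_rel X R `` {[(x, False)]} \<otimes>\<^bsub>presented_group X R\<^esub> pres_gen X R x =
        \<one>\<^bsub>presented_group X R\<^esub>"
      by (simp only: presented_group_one append.simps)
    show "pres_gen X R x \<in> carrier (presented_group X R)"
      using a pres_gen_closed[of X R] by blast
    have "[(x, False)] \<in> gwords X"
      using a by simp
    then show "pres_rel X R `` {[(x, False)]} \<in> carrier (presented_group X R)"
      unfolding presented_group_carrier_iff by blast
  qed
  then have "letter_val (presented_group X R) (pres_gen X R) a = pres_rel X R `` {[a]}"
    using a by (cases b) (simp_all add: letter_val_def pres_gen_def)
  moreover have "pres_rel X R `` {a # w} =
      pres_rel X R `` {[a]} \<otimes>\<^bsub>presented_group X R\<^esub> pres_rel X R `` {w}"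
    using Cons.prems by (simp add: presented_group_mult)
  moreover have "pres_rel X R `` {w} = word_val (presented_group X R) (pres_gen X R) w"
    using Cons by simp
  ultimately show ?case by simp
qed

lemma presented_group_carrierE:
  assumes "A \<in> carrier (presented_group X R)"
  obtains w where "w \<in> gwords X" "A = word_val (presented_group X R) (pres_gen X R) w"
  using assms presented_group_class_eq_word_val[of _ X R] by (auto simp: presented_group_carrier_iff)

lemma presented_group_hom_relation:
  assumes "group H" "h \<in> hom (presented_group X R) H"
    and "(l, r) \<in> R" "l \<in> gwords X" "r \<in> gwords X"
  shows "word_val H (h \<circ> pres_gen X R) l = word_val H (h \<circ> pres_gen X R) r"
proof -
  have hom: "group_hom (presented_group X R) H h"
    using assms group_presented_group by (simp add: group_hom_def group_hom_axioms_def)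
  have "(l, r) \<in> pres_rel X R"
    using pres_rel.relator[of "[]" X "[]" l r R] assms by simp
  then have "pres_rel X R `` {l} = pres_rel X R `` {r}"
    by (rule equiv_class_eq[OF equiv_pres_rel])
  then have "h (word_val (presented_group X R) (pres_gen X R) l) =
      h (word_val (presented_group X R) (pres_gen X R) r)"
    using assms by (simp add: presented_group_class_eq_word_val)
  then show ?thesis
    using assms by (simp add: word_val_hom[OF hom pres_gen_closed])
qed

theorem presented_group_universal:
  assumes "group H" and f: "f ` X \<subseteq> carrier H"
    and rels: "\<And>l r. (l, r) \<in> R \<Longrightarrow> l \<in> gwords X \<Longrightarrow> r \<in> gwords X \<Longrightarrow> word_val H f l = word_val H f r"
  obtains h where "h \<in> hom (presented_group X R) H" "\<And>x. x \<in> X \<Longrightarrow> h (pres_gen X R x) = f x"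
proof -
  interpret H: group H by fact
  define h where "h = (\<lambda>A. word_val H f (SOME w. w \<in> A))"
  have h: "h (pres_rel X R `` {w}) = word_val H f w" if "w \<in> gwords X" for w
  proof -
    have "(SOME v. v \<in> pres_rel X R `` {w}) \<in> pres_rel X R `` {w}"
      by (rule someI[of _ w]) (simp add: that pres_rel.refl)
    then show ?thesis
      using H.word_val_pres_rel[OF f rels] by (simp add: h_def)
  qed
  show thesis
  proof (rule that)
    show "h \<in> hom (presented_group X R) H"
      by (rule homI) (auto simp: presented_group_carrier_iff presented_group_mult h
          H.word_val_append[OF f] H.word_val_closed[OF f])
    show "h (pres_gen X R x) = f x" if "x \<in> X" for x
    proof -
      have "f x \<in> carrier H" using that f by blast
      then show ?thesis using that by (simp add: pres_gen_def h letter_val_def)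
    qed
  qed
qed

section \<open>The symmetric group as a quotient\<close>

definition adj :: "nat \<Rightarrow> nat \<Rightarrow> nat" where
  "adj i = transpose i (Suc i)"

lemma adj_relations:
  "adj i \<circ> adj i = id"
  "adj i \<circ> (adj (Suc i) \<circ> adj i) = adj (Suc i) \<circ> (adj i \<circ> adj (Suc i))"
  "far n i j \<Longrightarrow> adj i \<circ> adj j = adj j \<circ> adj i"
  by (auto simp: adj_def far_def transpose_def fun_eq_iff)

lemma adj_permutes: "1 \<le> i \<Longrightarrow> i < n \<Longrightarrow> adj i permutes {1..n}"
  by (auto simp: adj_def intro: permutes_swap_id)

fun mv_index :: "mv_gen \<Rightarrow> nat" where
  "mv_index (MVrho b i) = i"
| "mv_index (MVsig i) = i"

lemma mv_index_q_gen:
  "mv_index (q_gen k (UVrho i)) = i"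
  "mv_index (q_gen k (UVsig i t)) = i"
  by simp_all

definition adj_prod :: "nat list \<Rightarrow> nat \<Rightarrow> nat" where
  "adj_prod is = foldr (\<lambda>i p. adj i \<circ> p) is id"

lemma adj_prod_relations:
  "adj_prod [i, i] = adj_prod []"
  "adj_prod [i, Suc i, i] = adj_prod [Suc i, i, Suc i]"
  "far n i j \<Longrightarrow> adj_prod [i, j] = adj_prod [j, i]"
  using adj_relations by (simp_all add: adj_prod_def)

text \<open>When only the indices of the generators are kept, every relation, including the mixed and the
  forbidden ones, becomes one of the three Coxeter relations of the adjacent transpositions.\<close>

lemma mv_index_relations:
  assumes "(l, r) \<in> mvb_rels n k \<union> q_rels k (forbidden_rels n k)"
  shows "adj_prod (map mv_index l) = adj_prod (map mv_index r)"
proof -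
  have uv: "adj_prod (map (mv_index \<circ> q_gen k) l) = adj_prod (map (mv_index \<circ> q_gen k) r)"
    if "(l, r) \<in> uv_rels n k \<union> forbidden_rels n k" for l r
    using that adj_prod_relations(3)
    unfolding uv_rels_def forbidden_rels_def
    by (elim UnE CollectE exE conjE) (simp_all only: prod.inject list.map o_apply mv_index_q_gen
        adj_prod_relations(1,2) Suc_eq_plus1[symmetric])
  consider l' r' where "(l', r') \<in> uv_rels n k \<union> forbidden_rels n k"
      "l = map (q_gen k) l'" "r = map (q_gen k) r'"
    | t i where "l = [MVrho t i, MVrho t i]" "r = []"
    | t i where "l = [MVrho t i, MVrho t (i+1), MVrho t i]"
        "r = [MVrho t (i+1), MVrho t i, MVrho t (i+1)]"
    | i where "l = [MVsig i, MVsig (i+1), MVsig i]" "r = [MVsig (i+1), MVsig i, MVsig (i+1)]"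
    using assms unfolding mvb_rels_def q_rels_def by fastforce
  then show ?thesis
  proof cases
    case 1
    then show ?thesis using uv[OF 1(1)] by (simp add: comp_def)
  qed (simp_all add: adj_prod_relations)
qed

lemma word_val_sym_group_poswd:
  "word_val (sym_group n) (adj \<circ> mv_index) (poswd xs) = adj_prod (map mv_index xs)"
  by (induction xs) (simp_all add: letter_val_def sym_group_one sym_group_mult adj_prod_def)

lemma set_uv_rels_subset:
  "(l, r) \<in> uv_rels n k \<Longrightarrow> set l \<union> set r \<subseteq> uv_gens n k"
  unfolding uv_rels_def
  by (elim UnE CollectE exE conjE) (simp_all add: uv_gens_def far_def)

definition mub_gen :: "nat \<Rightarrow> nat \<Rightarrow> mv_gen \<Rightarrow> mv_gen gword set" where
  "mub_gen n k = pres_gen (mv_gens n k)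
    (map_prod poswd poswd ` (mvb_rels n k \<union> q_rels k (forbidden_rels n k)))"

lemma MUB_universal_sym_group:
  obtains h where "h \<in> hom (MUB n k) (sym_group n)"
    "\<And>x. x \<in> mv_gens n k \<Longrightarrow> h (mub_gen n k x) = adj (mv_index x)"
proof -
  let ?R = "map_prod poswd poswd ` (mvb_rels n k \<union> q_rels k (forbidden_rels n k))"
  have f: "(adj \<circ> mv_index) ` mv_gens n k \<subseteq> carrier (sym_group n)"
    by (auto simp: mv_gens_def sym_group_carrier adj_permutes[unfolded One_nat_def])
  have "word_val (sym_group n) (adj \<circ> mv_index) l = word_val (sym_group n) (adj \<circ> mv_index) r"
    if lr: "(l, r) \<in> ?R" for l r
  proof -
    obtain x where "(l, r) = map_prod poswd poswd x"
        "x \<in> mvb_rels n k \<union> q_rels k (forbidden_rels n k)"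
      using lr by (rule imageE)
    then have "(fst x, snd x) \<in> mvb_rels n k \<union> q_rels k (forbidden_rels n k)"
        "l = poswd (fst x)" "r = poswd (snd x)"
      by (simp_all add: map_prod_def split: prod.splits)
    then show ?thesis
      using mv_index_relations by (simp only: word_val_sym_group_poswd)
  qed
  then show thesis
  proof (rule presented_group_universal[OF sym_group_is_group f, of ?R])
    fix h assume "h \<in> hom (presented_group (mv_gens n k) ?R) (sym_group n)"
      and "\<And>x. x \<in> mv_gens n k \<Longrightarrow> h (pres_gen (mv_gens n k) ?R x) = (adj \<circ> mv_index) x"
    then show thesis
      using that[of h] by (simp add: MUB_def mub_gen_def)
  qed
qed

lemma MUB_onto_sym_group:
  assumes "k \<ge> 1"
  obtains h where "h \<in> hom (MUB n k) (sym_group n)" "h ` carrier (MUB n k) = carrier (sym_group n)"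
proof -
  obtain h where h: "h \<in> hom (MUB n k) (sym_group n)"
    and gen: "\<And>x. x \<in> mv_gens n k \<Longrightarrow> h (mub_gen n k x) = adj (mv_index x)"
    using MUB_universal_sym_group[of n k] by blast
  interpret h: group_hom "MUB n k" "sym_group n" h
    using h group_MUB sym_group_is_group by (simp add: group_hom_def group_hom_axioms_def)
  have "p \<in> h ` carrier (MUB n k)" if "p permutes {1..n}" for p
    using that
  proof (induction rule: adjacent_transpositions_induct)
    case id
    then show ?case
      using h.hom_one by (auto simp: sym_group_one intro!: image_eqI[of _ _ "\<one>\<^bsub>MUB n k\<^esub>"])
  next
    case (adjacent i)
    have x: "MVsig i \<in> mv_gens n k"
      using adjacent by (auto simp: mv_gens_def)
    then have "mub_gen n k (MVsig i) \<in> carrier (MUB n k)"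
      unfolding mub_gen_def MUB_def using pres_gen_closed[of "mv_gens n k"] by blast
    then show ?case
      using gen[OF x] by (auto simp: adj_def intro!: image_eqI[of _ _ "mub_gen n k (MVsig i)"])
  next
    case (comp p q)
    obtain a b where ab: "a \<in> carrier (MUB n k)" "b \<in> carrier (MUB n k)" "p = h a" "q = h b"
      using comp.IH by blast
    then have "h (a \<otimes>\<^bsub>MUB n k\<^esub> b) = p \<circ> q"
      by (simp add: sym_group_mult)
    then show ?case
      using ab by (metis h.G.m_closed imageI)
  qed
  then have "carrier (sym_group n) \<subseteq> h ` carrier (MUB n k)"
    by (auto simp: sym_group_carrier)
  then show thesis
    using that[OF h] h.hom_closed by blast
qed

section \<open>Homomorphic images of the multi-unrestricted braid group\<close>

locale MUB_image = group_hom "MUB n k" H h for n k and H (structure) and h +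
  assumes k: "k \<ge> 1"
begin

text \<open>Indexing the images by the generators of the universal virtual braid group treats the
  \<open>\<rho>\<^sub>i\<^sup>(\<^sup>t\<^sup>)\<close> with \<open>t \<ge> 1\<close> and the \<open>\<sigma>\<^sub>i\<close> uniformly as \<open>\<sigma>\<^bsub>i,t\<^esub>\<close>.\<close>

definition uv_img :: "uv_gen \<Rightarrow> 'a" where
  "uv_img x = h (mub_gen n k (q_gen k x))"

lemma uv_img_closed: "x \<in> uv_gens n k \<Longrightarrow> uv_img x \<in> carrier H"
proof -
  assume "x \<in> uv_gens n k"
  then have "q_gen k x \<in> mv_gens n k"
    using q_gen_image[OF k, of n] by blast
  then have "mub_gen n k (q_gen k x) \<in> carrier (MUB n k)"
    unfolding mub_gen_def MUB_def using pres_gen_closed[of "mv_gens n k"] by blast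
  then show ?thesis
    unfolding uv_img_def by (rule hom_closed)
qed

lemma uv_relation:
  assumes "(l, r) \<in> uv_rels n k"
  shows "word_val H uv_img (poswd l) = word_val H uv_img (poswd r)"
proof -
  let ?R = "map_prod poswd poswd ` (mvb_rels n k \<union> q_rels k (forbidden_rels n k))"
  have "q_gen k ` (set l \<union> set r) \<subseteq> mv_gens n k"
    using set_uv_rels_subset[OF assms] q_gen_image[OF k, of n] by blast
  then have words: "poswd (map (q_gen k) l) \<in> gwords (mv_gens n k)"
      "poswd (map (q_gen k) r) \<in> gwords (mv_gens n k)"
    by (simp_all add: poswd_in_gwords_iff image_Un)
  have "(map (q_gen k) l, map (q_gen k) r) \<in> mvb_rels n k \<union> q_rels k (forbidden_rels n k)"
    using assms by (force simp: mvb_rels_def q_rels_def)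
  then have "(poswd (map (q_gen k) l), poswd (map (q_gen k) r)) \<in> ?R"
    by force
  moreover have "h \<in> hom (presented_group (mv_gens n k) ?R) H"
    using homh by (simp add: MUB_def)
  ultimately have "word_val H (h \<circ> mub_gen n k) (poswd (map (q_gen k) l)) =
      word_val H (h \<circ> mub_gen n k) (poswd (map (q_gen k) r))"
    unfolding mub_gen_def
    using words H.group_axioms by (intro presented_group_hom_relation) auto
  moreover have "h \<circ> mub_gen n k \<circ> q_gen k = uv_img"
    by (simp add: fun_eq_iff uv_img_def)
  ultimately show ?thesis
    by (simp add: word_val_map_poswd)
qed

lemma rho_closed: "1 \<le> i \<Longrightarrow> i < n \<Longrightarrow> uv_img (UVrho i) \<in> carrier H"
  and sig_closed: "1 \<le> i \<Longrightarrow> i < n \<Longrightarrow> 1 \<le> t \<Longrightarrow> t \<le> k \<Longrightarrow> uv_img (UVsig i t) \<in> carrier H"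
  by (auto intro!: uv_img_closed simp: uv_gens_def)

sublocale rho: coxeter_images H "\<lambda>i. uv_img (UVrho i)" n
proof
  fix i assume i: "1 \<le> i" "i < n"
  then show "uv_img (UVrho i) \<in> carrier H"
    by (rule rho_closed)
  have "([UVrho i, UVrho i], []) \<in> uv_rels n k"
    using i by (auto simp: uv_rels_def)
  from uv_relation[OF this] show "uv_img (UVrho i) \<otimes> uv_img (UVrho i) = \<one>"
    using i by (simp add: letter_val_def rho_closed)
next
  fix i assume i: "1 \<le> i" "Suc i < n"
  have "([UVrho i, UVrho (i+1), UVrho i], [UVrho (i+1), UVrho i, UVrho (i+1)]) \<in> uv_rels n k"
    using i unfolding uv_rels_def by simp
  from uv_relation[OF this]
  show "uv_img (UVrho i) \<otimes> uv_img (UVrho (Suc i)) \<otimes> uv_img (UVrho i) =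
      uv_img (UVrho (Suc i)) \<otimes> uv_img (UVrho i) \<otimes> uv_img (UVrho (Suc i))"
    using i by (simp add: letter_val_def rho_closed H.m_assoc)
next
  fix i j assume ij: "1 \<le> i" "Suc (Suc i) \<le> j" "j < n"
  then have "([UVrho i, UVrho j], [UVrho j, UVrho i]) \<in> uv_rels n k"
    unfolding uv_rels_def by (simp add: far_def)
  from uv_relation[OF this]
  show "uv_img (UVrho i) \<otimes> uv_img (UVrho j) = uv_img (UVrho j) \<otimes> uv_img (UVrho i)"
    using ij by (simp add: letter_val_def rho_closed)
qed

lemma sig_rho_far:
  assumes "far n i j" "1 \<le> t" "t \<le> k"
  shows "uv_img (UVsig i t) \<otimes> uv_img (UVrho j) = uv_img (UVrho j) \<otimes> uv_img (UVsig i t)"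
proof -
  have "([UVsig i t, UVrho j], [UVrho j, UVsig i t]) \<in> uv_rels n k"
    using assms unfolding uv_rels_def by simp
  from uv_relation[OF this] show ?thesis
    using assms by (simp add: letter_val_def rho_closed sig_closed far_def)
qed

lemma sig_sig_far:
  assumes "far n i j" "1 \<le> t" "t \<le> k" "1 \<le> l" "l \<le> k"
  shows "uv_img (UVsig i t) \<otimes> uv_img (UVsig j l) = uv_img (UVsig j l) \<otimes> uv_img (UVsig i t)"
proof -
  have "([UVsig i t, UVsig j l], [UVsig j l, UVsig i t]) \<in> uv_rels n k"
    using assms unfolding uv_rels_def by simp
  from uv_relation[OF this] show ?thesis
    using assms by (simp add: letter_val_def sig_closed far_def)
qed

lemma rho_rho_sig:
  assumes "1 \<le> i" "Suc i < n" "1 \<le> t" "t \<le> k"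
  shows "uv_img (UVrho i) \<otimes> uv_img (UVrho (Suc i)) \<otimes> uv_img (UVsig i t) =
    uv_img (UVsig (Suc i) t) \<otimes> (uv_img (UVrho i) \<otimes> uv_img (UVrho (Suc i)))"
proof -
  have "([UVrho i, UVrho (i+1), UVsig i t], [UVsig (i+1) t, UVrho i, UVrho (i+1)]) \<in> uv_rels n k"
    using assms unfolding uv_rels_def by simp
  from uv_relation[OF this] show ?thesis
    using assms by (simp add: letter_val_def rho_closed sig_closed H.m_assoc)
qed

text \<open>The product of two neighbouring images of the \<open>\<rho>\<^sub>i\<close> is now the square of an involution, hence
  trivial, and the mixed relation says that \<open>\<sigma>\<^bsub>i,t\<^esub>\<close> and \<open>\<sigma>\<^bsub>i+1,t\<^esub>\<close> have the same image. Any two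
  generators can thus be placed at the positions 1 and 3, where they commute.\<close>

lemma uv_img_commute_if_rho_equal:
  assumes n: "n \<ge> 4" and rho: "\<And>i. 1 \<le> i \<Longrightarrow> i < n \<Longrightarrow> uv_img (UVrho i) = uv_img (UVrho 1)"
    and x: "x \<in> uv_gens n k" and y: "y \<in> uv_gens n k"
  shows "uv_img x \<otimes> uv_img y = uv_img y \<otimes> uv_img x"
proof -
  have sig_step: "uv_img (UVsig (Suc i) t) = uv_img (UVsig i t)"
    if "1 \<le> i" "Suc i < n" "1 \<le> t" "t \<le> k" for i t
  proof -
    have "uv_img (UVrho i) \<otimes> uv_img (UVrho (Suc i)) = \<one>"
      using rho[of i] rho[of "Suc i"] rho.r_invol[of i] that by simp
    then show ?thesis
      using rho_rho_sig[OF that] that sig_closed by simp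
  qed
  have sig: "uv_img (UVsig i t) = uv_img (UVsig 1 t)" if "1 \<le> i" "i < n" "1 \<le> t" "t \<le> k" for i t
    using that(1,2)
  proof (induction i rule: dec_induct)
    case (step i)
    then show ?case using \<open>1 \<le> t\<close> \<open>t \<le> k\<close> sig_step[of i t] by simp
  qed simp
  have far: "far n 1 3"
    using n by (simp add: far_def)
  have ss: "uv_img (UVsig 1 t) \<otimes> uv_img (UVsig 1 l) = uv_img (UVsig 1 l) \<otimes> uv_img (UVsig 1 t)"
    if "1 \<le> t" "t \<le> k" "1 \<le> l" "l \<le> k" for t l
    using sig_sig_far[OF far that] sig[of 3 l] n that by simp
  have sr: "uv_img (UVsig 1 t) \<otimes> uv_img (UVrho 1) = uv_img (UVrho 1) \<otimes> uv_img (UVsig 1 t)"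
    if "1 \<le> t" "t \<le> k" for t
    using sig_rho_far[OF far that] rho[of 3] n that by simp
  have val: "uv_img z = uv_img (UVrho 1) \<or> (\<exists>t. 1 \<le> t \<and> t \<le> k \<and> uv_img z = uv_img (UVsig 1 t))"
    if z: "z \<in> uv_gens n k" for z
  proof -
    consider i where "z = UVrho i" "1 \<le> i" "i < n"
      | i t where "z = UVsig i t" "1 \<le> i" "i < n" "1 \<le> t" "t \<le> k"
      using z unfolding uv_gens_def by blast
    then show ?thesis
      using rho sig by cases blast+
  qed
  show ?thesis
    using val[OF x] val[OF y] ss sr by auto
qed

theorem image_commute_if_rho_equal:
  assumes n: "n \<ge> 4" and rho: "\<And>i. 1 \<le> i \<Longrightarrow> i < n \<Longrightarrow> uv_img (UVrho i) = uv_img (UVrho 1)"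
    and a: "a \<in> carrier (MUB n k)" and b: "b \<in> carrier (MUB n k)"
  shows "h a \<otimes> h b = h b \<otimes> h a"
proof -
  have gen: "mub_gen n k ` mv_gens n k \<subseteq> carrier (MUB n k)"
    unfolding mub_gen_def MUB_def by (rule pres_gen_closed)
  obtain v w where v: "v \<in> gwords (mv_gens n k)" "a = word_val (MUB n k) (mub_gen n k) v"
    and w: "w \<in> gwords (mv_gens n k)" "b = word_val (MUB n k) (mub_gen n k) w"
    using a b unfolding MUB_def mub_gen_def by (metis presented_group_carrierE)
  have "word_val H (h \<circ> mub_gen n k) v \<otimes> word_val H (h \<circ> mub_gen n k) w =
      word_val H (h \<circ> mub_gen n k) w \<otimes> word_val H (h \<circ> mub_gen n k) v"
  proof (rule H.word_vals_commute[OF _ _ v(1) w(1)])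
    show "(h \<circ> mub_gen n k) ` mv_gens n k \<subseteq> carrier H"
      using gen hom_closed by auto
    fix x y assume "x \<in> mv_gens n k" "y \<in> mv_gens n k"
    then obtain x' y' where "x' \<in> uv_gens n k" "x = q_gen k x'" "y' \<in> uv_gens n k" "y = q_gen k y'"
      unfolding q_gen_image[OF k, symmetric] by blast
    then show "(h \<circ> mub_gen n k) x \<otimes> (h \<circ> mub_gen n k) y =
        (h \<circ> mub_gen n k) y \<otimes> (h \<circ> mub_gen n k) x"
      using uv_img_commute_if_rho_equal[OF n rho, of x' y'] by (simp add: uv_img_def)
  qed
  then show ?thesis
    using v w by (simp add: word_val_hom[OF group_hom_axioms gen])
qed

end

section \<open>Perfectness and the order of non-abelian quotients\<close>

lemma MUB_image_quotient:
  assumes "N \<lhd> MUB n k" "k \<ge> 1"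
  shows "MUB_image n k (MUB n k Mod N) (\<lambda>a. N #>\<^bsub>MUB n k\<^esub> a)"
proof -
  interpret N: normal N "MUB n k" by fact
  show ?thesis
    using assms(2) N.factorgroup_is_group N.r_coset_hom_Mod group_MUB
    by (simp add: MUB_image_def MUB_image_axioms_def group_hom_def group_hom_axioms_def)
qed

lemma MUB_quotient_abelian:
  assumes N: "N \<lhd> MUB n k" and k: "k \<ge> 1" and n: "n \<ge> 4"
    and rho: "\<And>i. 1 \<le> i \<Longrightarrow> i < n \<Longrightarrow>
      MUB_image.uv_img n k (\<lambda>a. N #>\<^bsub>MUB n k\<^esub> a) (UVrho i) =
      MUB_image.uv_img n k (\<lambda>a. N #>\<^bsub>MUB n k\<^esub> a) (UVrho 1)"
  shows "comm_group (MUB n k Mod N)"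
proof -
  interpret Q: MUB_image n k "MUB n k Mod N" "\<lambda>a. N #>\<^bsub>MUB n k\<^esub> a"
    using N k by (rule MUB_image_quotient)
  show ?thesis
  proof (rule Q.H.group_comm_groupI)
    fix A B assume "A \<in> carrier (MUB n k Mod N)" "B \<in> carrier (MUB n k Mod N)"
    then obtain a b where ab: "a \<in> carrier (MUB n k)" "b \<in> carrier (MUB n k)"
      and AB: "A = N #>\<^bsub>MUB n k\<^esub> a" "B = N #>\<^bsub>MUB n k\<^esub> b"
      by (auto simp: FactGroup_def RCOSETS_def)
    show "A \<otimes>\<^bsub>MUB n k Mod N\<^esub> B = B \<otimes>\<^bsub>MUB n k Mod N\<^esub> A"
      unfolding AB using n rho ab by (rule Q.image_commute_if_rho_equal)
  qed
qed

lemma perfect_commutator_subgroup_iff: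
  assumes "group G"
  shows "perfect_group (commutator_subgroup G) \<longleftrightarrow>
    derived G (derived G (carrier G)) = derived G (carrier G)"
proof -
  interpret group G by fact
  have sub: "subgroup (derived G (carrier G)) G"
    by (rule derived_is_subgroup) simp
  have "group (commutator_subgroup G)"
    unfolding commutator_subgroup_def using sub is_group by (rule subgroup.subgroup_is_group)
  moreover have "derived (commutator_subgroup G) (derived G (carrier G)) =
      derived G (derived G (carrier G))"
    unfolding commutator_subgroup_def using sub by (intro derived_consistent) simp_all
  ultimately show ?thesis
    by (simp add: perfect_group_def commutator_subgroup_def)
qed

text \<open>The quotient by the second derived subgroup is metabelian. There all \<open>\<rho>\<^sub>i\<close> coincide, which makes
  it abelian, so the second derived subgroup contains the first.\<close>

theorem derived_MUB_perfect:
  assumes n: "n \<ge> 5" and k: "k \<ge> 1"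
  shows "derived (MUB n k) (derived (MUB n k) (carrier (MUB n k))) =
    derived (MUB n k) (carrier (MUB n k))"
proof
  interpret G: group "MUB n k" by (rule group_MUB)
  let ?D = "derived (MUB n k) (carrier (MUB n k))"
  define N where "N = derived (MUB n k) ?D"
  have D: "?D \<subseteq> carrier (MUB n k)"
    by (rule G.derived_in_carrier) simp
  show "derived (MUB n k) ?D \<subseteq> ?D"
    using D by (rule G.mono_derived)
  have N: "N \<lhd> MUB n k"
    unfolding N_def by (intro G.derived_is_normal G.derived_self_is_normal)
  interpret N: normal N "MUB n k" by (rule N)
  let ?Q = "MUB n k Mod N" and ?\<pi> = "\<lambda>a. N #>\<^bsub>MUB n k\<^esub> a"
  interpret Q: MUB_image n k ?Q ?\<pi>
    using N k by (rule MUB_image_quotient)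
  have "carrier ?Q = ?\<pi> ` carrier (MUB n k)"
    by (auto simp: FactGroup_def RCOSETS_def)
  then have "derived ?Q (derived ?Q (carrier ?Q)) = ?\<pi> ` N"
    using Q.derived_img[OF subset_refl] Q.derived_img[OF D] by (simp only: N_def)
  also have "\<dots> \<subseteq> {\<one>\<^bsub>?Q\<^esub>}"
    using G.coset_join2[OF _ N.is_subgroup] N.subset by (auto simp: FactGroup_def)
  finally have Q'': "derived ?Q (derived ?Q (carrier ?Q)) \<subseteq> {\<one>\<^bsub>?Q\<^esub>}" .
  have "comm_group ?Q"
  proof (rule MUB_quotient_abelian[OF N k])
    show "n \<ge> 4" using n by simp
  qed (rule Q.rho.r_collapse_if_metabelian[OF n Q''])
  then show "?D \<subseteq> derived (MUB n k) ?D"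
    using G.derived_minimal[OF N] unfolding N_def by blast
qed

lemma fact_le_order_MUB_quotient:
  assumes n: "n \<ge> 5" and k: "k \<ge> 1" and N: "N \<lhd> MUB n k"
    and Q: "nonabelian_finite_group (MUB n k Mod N)"
  shows "fact n \<le> order (MUB n k Mod N)"
proof -
  interpret Q: MUB_image n k "MUB n k Mod N" "\<lambda>a. N #>\<^bsub>MUB n k\<^esub> a"
    using N k by (rule MUB_image_quotient)
  have "Q.uv_img (UVrho 1) \<noteq> Q.uv_img (UVrho 2)"
  proof
    assume "Q.uv_img (UVrho 1) = Q.uv_img (UVrho 2)"
    then have eq: "Q.uv_img (UVrho 1) = Q.uv_img (UVrho (Suc 1))"
      by (simp only: numeral_2_eq_2 One_nat_def)
    have rho: "Q.uv_img (UVrho i) = Q.uv_img (UVrho 1)" if "1 \<le> i" "i < n" for i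
      by (rule Q.rho.r_collapse[OF _ _ eq that]) (use n in simp_all)
    have "comm_group (MUB n k Mod N)"
    proof (rule MUB_quotient_abelian[OF N k])
      show "n \<ge> 4" using n by simp
    qed (rule rho)
    then show False
      using Q by (simp add: nonabelian_finite_group_def)
  qed
  then show ?thesis
    using Q n by (intro Q.rho.fact_le_order) (auto simp: nonabelian_finite_group_def)
qed

lemma nonabelian_finite_sym_group:
  assumes "n \<ge> 3"
  shows "nonabelian_finite_group (sym_group n)"
proof -
  have "\<not> comm_group (sym_group n)"
  proof
    assume "comm_group (sym_group n)"
    moreover have "adj 1 \<in> carrier (sym_group n)" "adj 2 \<in> carrier (sym_group n)"
      using assms by (simp_all add: sym_group_carrier adj_permutes[unfolded One_nat_def])
    ultimately have "adj 1 \<circ> adj 2 = adj 2 \<circ> adj 1"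
      using comm_monoid.m_comm[of "sym_group n"] by (metis comm_group_def sym_group_mult)
    then have "(adj 1 \<circ> adj 2) 1 = (adj 2 \<circ> adj 1) 1"
      by simp
    then show False
      by (simp add: adj_def transpose_def)
  qed
  then show ?thesis
    using sym_group_is_group by (simp add: nonabelian_finite_group_def sym_group_def finite_permutations)
qed

theorem corollary4p9:
  fixes n k :: nat
  assumes "n \<ge> 5" and "k \<ge> 1"
  shows "perfect_group (commutator_subgroup (MUB n k)) \<and>
    smallest_nonabelian_finite_quotient (MUB n k) (sym_group n)"
proof
  show "perfect_group (commutator_subgroup (MUB n k))"
    using derived_MUB_perfect[OF assms] by (simp add: perfect_commutator_subgroup_iff group_MUB)
  obtain h where h: "h \<in> hom (MUB n k) (sym_group n)" "h ` carrier (MUB n k) = carrier (sym_group n)"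
    using assms(2) by (rule MUB_onto_sym_group)
  interpret h: group_hom "MUB n k" "sym_group n" h
    using h group_MUB sym_group_is_group by (simp add: group_hom_def group_hom_axioms_def)
  have "\<exists>N. N \<lhd> MUB n k \<and> MUB n k Mod N \<cong> sym_group n"
    using h.normal_kernel h.FactGroup_iso[OF h(2)] by blast
  moreover have "order (sym_group n) = fact n"
    by (simp add: order_def sym_group_def card_permutations)
  ultimately show "smallest_nonabelian_finite_quotient (MUB n k) (sym_group n)"
    using assms fact_le_order_MUB_quotient nonabelian_finite_sym_group
    by (simp add: smallest_nonabelian_finite_quotient_def)
qed

end
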